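(* Let $X$ be a locally finite tree, and let $\Gamma$ and $\Gamma'$ be commensurable lattices in $\operatorname{Aut}(X)$, both acting without edge inversions on $X$. Then the quotient graphs $\Gamma\backslash X$ and $\Gamma'\backslash X$ have the same growth type.
   Context: $G=\operatorname{Aut}(X)$ is the locally compact group of simplicial automorphisms of $X$ (a neighborhood basis of the identity consists of the subgroups fixing larger and larger balls). A lattice in $G$ is a discrete subgroup $\Gamma$ with $\Gamma\backslash G$ of finite Haar measure. Two lattices $\Gamma_1,\Gamma_2\le G$ are commensurable (in $G$) if there exists $g\in G$ such that $g\Gamma_1g^{-1}\cap\Gamma_2$ has finite index in both $g\Gamma_1g^{-1}$ and $\Gamma_2$. For functions $f,g\colon\mathbb{N}\to\mathbb{N}$ write $f\preceq g$ if there are $\alpha,\beta\in\mathbb{N}$ with $f(k)\le\alpha\,g(k+\beta)$ for all $k$; $f$ and $g$ are equivalent if $f\preceq g$ and $g\preceq f$. The growth type of a (connected) locally finite graph $A$ with basepoint vertex $\star$ is the equivalence class of the function $g$ where $g(k)$ is the number of vertices in the combinatorial ball of radius $k$ centered at $\star$; it does not depend on the choice of $\star$. *)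

theory Defs
  imports
    "HOL-Analysis.Analysis"
    "HOL-Algebra.Bij"
    "HOL-Algebra.Coset"
    "HOL-Algebra.Group_Action"
    "Graph_Theory.Digraph_Component"
    "Graph_Theory.Pair_Digraph"
begin

section \<open>Graphs, balls and growth types\<close>

text \<open>
  Graphs are represented as symmetric digraphs: an undirected edge is a pair of opposite arcs.
  The predicates \<open>forest\<close> and \<open>tree\<close> of \<open>Digraph_Component\<close> are of no use
  here, because in a symmetric digraph the closed walk \<open>u, v, u\<close> is a \<open>cycle\<close> in the
  sense of \<open>Arc_Walk\<close>.  Such backtracking is the only degenerate cycle in a graph without
  loops and multiple edges, hence the bound on the length below.
\<close>

definition is_tree :: "'a pair_pre_digraph \<Rightarrow> bool" where
  "is_tree X \<longleftrightarrow>
     pair_bidirected_digraph X \<and>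
     Digraph_Component.connected (with_proj X) \<and>
     \<not> (\<exists>p. pre_digraph.cycle (with_proj X) p \<and> 3 \<le> length p)"

definition locally_finite :: "('a, 'b) pre_digraph \<Rightarrow> bool" where
  "locally_finite A \<longleftrightarrow> (\<forall>v\<in>verts A. finite (out_arcs A v))"

definition graph_ball :: "('a, 'b) pre_digraph \<Rightarrow> 'a \<Rightarrow> nat \<Rightarrow> 'a set" where
  "graph_ball A s k = {v. \<exists>p. pre_digraph.awalk A s p v \<and> length p \<le> k}"

definition growth_function :: "('a, 'b) pre_digraph \<Rightarrow> 'a \<Rightarrow> nat \<Rightarrow> nat" where
  "growth_function A s k = card (graph_ball A s k)"

definition growth_le :: "(nat \<Rightarrow> nat) \<Rightarrow> (nat \<Rightarrow> nat) \<Rightarrow> bool" where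
  "growth_le f g \<longleftrightarrow> (\<exists>\<alpha> \<beta>. \<forall>k. f k \<le> \<alpha> * g (k + \<beta>))"

definition growth_equiv :: "(nat \<Rightarrow> nat) \<Rightarrow> (nat \<Rightarrow> nat) \<Rightarrow> bool" where
  "growth_equiv f g \<longleftrightarrow> growth_le f g \<and> growth_le g f"

definition growth_type :: "('a, 'b) pre_digraph \<Rightarrow> 'a \<Rightarrow> (nat \<Rightarrow> nat) set" where
  "growth_type A s = {f. growth_equiv f (growth_function A s)}"

section \<open>The topological group of automorphisms\<close>

definition Aut :: "'a pair_pre_digraph \<Rightarrow> ('a \<Rightarrow> 'a) monoid" where
  "Aut X = (BijGroup (pverts X))
     \<lparr>carrier := {f \<in> Bij (pverts X). \<forall>u\<in>pverts X. \<forall>v\<in>pverts X.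
        (u, v) \<in> parcs X \<longleftrightarrow> (f u, f v) \<in> parcs X}\<rparr>"

definition ball_fixator :: "'a pair_pre_digraph \<Rightarrow> 'a \<Rightarrow> nat \<Rightarrow> ('a \<Rightarrow> 'a) set" where
  "ball_fixator X x r =
     {f \<in> carrier (Aut X). \<forall>v\<in>graph_ball (with_proj X) x r. f v = v}"

definition aut_open :: "'a pair_pre_digraph \<Rightarrow> ('a \<Rightarrow> 'a) set \<Rightarrow> bool" where
  "aut_open X U \<longleftrightarrow> U \<subseteq> carrier (Aut X) \<and>
     (\<forall>g\<in>U. \<forall>x\<in>pverts X. \<exists>r. g <#\<^bsub>Aut X\<^esub> ball_fixator X x r \<subseteq> U)"

definition aut_topology :: "'a pair_pre_digraph \<Rightarrow> ('a \<Rightarrow> 'a) topology" where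
  "aut_topology X = topology (aut_open X)"

lemma graph_ball_mono: "r \<le> s \<Longrightarrow> graph_ball A x r \<subseteq> graph_ball A x s"
  by (auto simp: graph_ball_def intro: le_trans)

lemma ball_fixator_antimono: "r \<le> s \<Longrightarrow> ball_fixator X x s \<subseteq> ball_fixator X x r"
  using graph_ball_mono[of r s "with_proj X" x] by (auto simp: ball_fixator_def)

lemma istopology_aut_open: "istopology (aut_open X)"
  unfolding istopology_def
proof (intro conjI allI impI)
  fix S T assume S: "aut_open X S" and T: "aut_open X T"
  have "\<exists>r. g <#\<^bsub>Aut X\<^esub> ball_fixator X x r \<subseteq> S \<inter> T"
    if g: "g \<in> S" "g \<in> T" and x: "x \<in> pverts X" for g x
  proof -
    obtain r s where r: "g <#\<^bsub>Aut X\<^esub> ball_fixator X x r \<subseteq> S"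
      and s: "g <#\<^bsub>Aut X\<^esub> ball_fixator X x s \<subseteq> T"
      using S T g x unfolding aut_open_def by meson
    have "g <#\<^bsub>Aut X\<^esub> ball_fixator X x (max r s) \<subseteq> S \<inter> T"
      using r s ball_fixator_antimono[of r "max r s" X x] ball_fixator_antimono[of s "max r s" X x]
      unfolding l_coset_def by force
    then show ?thesis ..
  qed
  with S show "aut_open X (S \<inter> T)" unfolding aut_open_def by blast
next
  fix \<K> assume *: "\<forall>K\<in>\<K>. aut_open X K"
  have "\<exists>r. g <#\<^bsub>Aut X\<^esub> ball_fixator X x r \<subseteq> \<Union>\<K>"
    if "g \<in> K" "K \<in> \<K>" "x \<in> pverts X" for g K x
    using * that unfolding aut_open_def by (meson Union_upper subset_trans)
  with * show "aut_open X (\<Union>\<K>)" unfolding aut_open_def by blast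
qed

lemma openin_aut_topology: "openin (aut_topology X) = aut_open X"
  unfolding aut_topology_def by (rule topology_inverse'[OF istopology_aut_open])

section \<open>Haar measure and lattices\<close>

text \<open>
  In this section \<open>G\<close> is a group and \<open>T\<close> a topology with \<open>topspace T = carrier G\<close>,
  making \<open>G\<close> a locally compact Hausdorff group.
\<close>

definition haar_measure :: "('g, 'm) monoid_scheme \<Rightarrow> 'g topology \<Rightarrow> 'g measure \<Rightarrow> bool" where
  "haar_measure G T \<mu> \<longleftrightarrow>
     sets \<mu> = sets (sigma (topspace T) {U. openin T U}) \<and>
     (\<forall>K. compactin T K \<longrightarrow> emeasure \<mu> K < \<infinity>) \<and>
     (\<forall>A\<in>sets \<mu>. emeasure \<mu> A = (INF U\<in>{U. openin T U \<and> A \<subseteq> U}. emeasure \<mu> U)) \<and>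
     (\<forall>U. openin T U \<longrightarrow>
        emeasure \<mu> U = (SUP K\<in>{K. compactin T K \<and> K \<subseteq> U}. emeasure \<mu> K)) \<and>
     (\<forall>g\<in>carrier G. \<forall>A\<in>sets \<mu>. emeasure \<mu> (g <#\<^bsub>G\<^esub> A) = emeasure \<mu> A) \<and>
     emeasure \<mu> (space \<mu>) \<noteq> 0"

definition discrete_subgroup :: "('g, 'm) monoid_scheme \<Rightarrow> 'g topology \<Rightarrow> 'g set \<Rightarrow> bool" where
  "discrete_subgroup G T \<Gamma> \<longleftrightarrow>
     subgroup \<Gamma> G \<and> subtopology T \<Gamma> = discrete_topology \<Gamma>"

text \<open>
  \<open>\<Gamma>\G\<close> is the set \<open>rcosets\<^bsub>G\<^esub> \<Gamma>\<close> of cosets \<open>\<Gamma>g\<close>.  The measure \<open>\<nu>\<close> that a left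
  Haar measure \<open>\<mu>\<close> induces on it is characterised by Weil's formula
  \<open>\<integral>\<^bsub>G\<^esub> f d\<mu> = \<integral>\<^bsub>\<Gamma>\G\<^esub> (\<Sum>\<gamma>\<in>\<Gamma>. f (\<gamma>g)) d\<nu>\<close>.
  For an indicator function \<open>f\<close> of \<open>A\<close> the inner sum is the number of elements of
  \<open>A \<inter> \<Gamma>g\<close>.  In particular \<open>\<nu>\<close> assigns to the image of \<open>A\<close> the value \<open>\<mu>(A)\<close>
  whenever \<open>A\<close> is mapped injectively to \<open>\<Gamma>\G\<close>.
\<close>

definition induced_quotient_measure ::
  "('g, 'm) monoid_scheme \<Rightarrow> 'g set \<Rightarrow> 'g measure \<Rightarrow> 'g set measure \<Rightarrow> bool" where
  "induced_quotient_measure G \<Gamma> \<mu> \<nu> \<longleftrightarrow>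
     space \<nu> = rcosets\<^bsub>G\<^esub> \<Gamma> \<and>
     sets \<nu> = {W. W \<subseteq> rcosets\<^bsub>G\<^esub> \<Gamma> \<and> \<Union>W \<in> sets \<mu>} \<and>
     (\<forall>A\<in>sets \<mu>. emeasure \<mu> A = (\<integral>\<^sup>+ C. emeasure (count_space UNIV) (A \<inter> C) \<partial>\<nu>))"

definition is_lattice :: "('g, 'm) monoid_scheme \<Rightarrow> 'g topology \<Rightarrow> 'g set \<Rightarrow> bool" where
  "is_lattice G T \<Gamma> \<longleftrightarrow> discrete_subgroup G T \<Gamma> \<and>
     (\<exists>\<mu> \<nu>. haar_measure G T \<mu> \<and> induced_quotient_measure G \<Gamma> \<mu> \<nu> \<and>
        emeasure \<nu> (space \<nu>) < \<infinity>)"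

definition finite_index :: "('g, 'm) monoid_scheme \<Rightarrow> 'g set \<Rightarrow> 'g set \<Rightarrow> bool" where
  "finite_index G H K \<longleftrightarrow> H \<subseteq> K \<and> finite (rcosets\<^bsub>G\<lparr>carrier := K\<rparr>\<^esub> H)"

definition commensurable :: "('g, 'm) monoid_scheme \<Rightarrow> 'g set \<Rightarrow> 'g set \<Rightarrow> bool" where
  "commensurable G \<Gamma>\<^sub>1 \<Gamma>\<^sub>2 \<longleftrightarrow> (\<exists>g\<in>carrier G.
     let \<Gamma>\<^sub>1' = g <#\<^bsub>G\<^esub> \<Gamma>\<^sub>1 #>\<^bsub>G\<^esub> inv\<^bsub>G\<^esub> g in
       finite_index G (\<Gamma>\<^sub>1' \<inter> \<Gamma>\<^sub>2) \<Gamma>\<^sub>1' \<and> finite_index G (\<Gamma>\<^sub>1' \<inter> \<Gamma>\<^sub>2) \<Gamma>\<^sub>2)"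

section \<open>Quotient graphs\<close>

definition acts_without_inversions :: "'a pair_pre_digraph \<Rightarrow> ('a \<Rightarrow> 'a) set \<Rightarrow> bool" where
  "acts_without_inversions X \<Gamma> \<longleftrightarrow>
     \<not> (\<exists>\<gamma>\<in>\<Gamma>. \<exists>(u, v)\<in>parcs X. \<gamma> u = v \<and> \<gamma> v = u)"

text \<open>
  The quotient may have loops and multiple edges, so its arcs are the orbits of arcs.
  All arcs in an orbit have their tails in one vertex orbit, which is the image of the arc orbit
  under \<^term>\<open>fst\<close>, and likewise for heads.
\<close>

definition quotient_graph ::
  "'a pair_pre_digraph \<Rightarrow> ('a \<Rightarrow> 'a) set \<Rightarrow> ('a set, ('a \<times> 'a) set) pre_digraph" where
  "quotient_graph X \<Gamma> =
     \<lparr>verts = orbits (Aut X\<lparr>carrier := \<Gamma>\<rparr>) (pverts X) (\<lambda>\<gamma>. \<gamma>),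
      arcs = orbits (Aut X\<lparr>carrier := \<Gamma>\<rparr>) (parcs X) (\<lambda>\<gamma>. map_prod \<gamma> \<gamma>),
      tail = (\<lambda>e. fst ` e),
      head = (\<lambda>e. snd ` e)\<rparr>"

end

theory Submission
  imports Defs
begin

text \<open>
  Walks lift along \<open>X \<rightarrow> \<Gamma>\X\<close>, so the ball of radius \<open>k\<close> about \<open>\<Gamma>x\<close> is the image of the ball of
  radius \<open>k\<close> about \<open>x\<close>, and growth counts the orbits that meet a ball of \<open>X\<close>.  If \<open>\<Lambda> \<le> \<Gamma>\<close> has
  index \<open>n\<close>, every \<open>\<Gamma>\<close>-orbit is a union of at most \<open>n\<close> orbits of \<open>\<Lambda>\<close>; hence the two counts
  differ by a factor of at most \<open>n\<close>.  Conjugating \<open>\<Gamma>\<close> by \<open>g\<close> moves the basepoint to \<open>gx\<close>, and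
  moving the basepoint shifts the radius by a constant.
\<close>

section \<open>Comparison of growth functions\<close>

lemma growth_le_trans:
  assumes "growth_le f g" "growth_le g h"
  shows "growth_le f h"
proof -
  obtain a b where ab: "\<And>k. f k \<le> a * g (k + b)"
    using assms(1) unfolding growth_le_def by blast
  obtain c d where cd: "\<And>k. g k \<le> c * h (k + d)"
    using assms(2) unfolding growth_le_def by blast
  have "f k \<le> (a * c) * h (k + (b + d))" for k
  proof -
    have "f k \<le> a * g (k + b)" by (rule ab)
    also have "\<dots> \<le> a * (c * h (k + b + d))" by (intro mult_le_mono2 cd)
    finally show ?thesis by (simp add: ac_simps)
  qed
  then show ?thesis unfolding growth_le_def by blast
qed

lemma growth_equiv_sym: "growth_equiv f g \<Longrightarrow> growth_equiv g f"
  by (simp add: growth_equiv_def)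

lemma growth_equiv_trans: "growth_equiv f g \<Longrightarrow> growth_equiv g h \<Longrightarrow> growth_equiv f h"
  unfolding growth_equiv_def using growth_le_trans by blast

text \<open>Growth types are classes of a symmetric and transitive relation, so related functions
  determine the same class.\<close>

lemma growth_type_eqI:
  "growth_equiv (growth_function A s) (growth_function B t) \<Longrightarrow> growth_type A s = growth_type B t"
  unfolding growth_type_def using growth_equiv_trans growth_equiv_sym by blast

section \<open>Balls in a directed graph\<close>

context wf_digraph
begin

lemma graph_ball_0: "s \<in> verts G \<Longrightarrow> graph_ball G s 0 = {s}"
  by (auto simp: graph_ball_def awalk_Nil_iff)

text \<open>Splitting off the first arc of a walk moves the center, so the inductions that use this
  recursion generalize over it. The separate \<open>insert s\<close> accounts for the empty walk,
  which matters when no arc leaves \<open>s\<close>.\<close>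

lemma graph_ball_Suc:
  assumes "s \<in> verts G"
  shows "graph_ball G s (Suc k) = insert s (\<Union>e\<in>out_arcs G s. graph_ball G (head G e) k)"
proof (intro Set.set_eqI iffI)
  fix v assume "v \<in> graph_ball G s (Suc k)"
  then obtain p where "awalk s p v" "length p \<le> Suc k"
    by (auto simp: graph_ball_def)
  then show "v \<in> insert s (\<Union>e\<in>out_arcs G s. graph_ball G (head G e) k)"
    by (cases p) (auto simp: graph_ball_def awalk_simps)
next
  fix v assume "v \<in> insert s (\<Union>e\<in>out_arcs G s. graph_ball G (head G e) k)"
  then consider "v = s"
    | e p where "e \<in> arcs G" "tail G e = s" "awalk (head G e) p v" "length p \<le> k"
    by (auto simp: graph_ball_def)
  then show "v \<in> graph_ball G s (Suc k)"
  proof cases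
    case 1
    then show ?thesis using assms by (auto simp: graph_ball_def awalk_Nil_iff intro: exI[of _ "[]"])
  next
    case 2
    then have "awalk s (e # p) v \<and> length (e # p) \<le> Suc k"
      by (simp add: awalk_Cons_iff)
    then show ?thesis unfolding graph_ball_def by blast
  qed
qed

lemma finite_graph_ball:
  assumes "locally_finite G" "s \<in> verts G"
  shows "finite (graph_ball G s k)"
  using assms(2)
proof (induction k arbitrary: s)
  case 0
  then show ?case by (simp add: graph_ball_0)
next
  case (Suc k)
  then show ?case using assms(1) by (auto simp: graph_ball_Suc locally_finite_def)
qed

lemma graph_ball_subset_verts: "graph_ball G s k \<subseteq> verts G"
  by (auto simp: graph_ball_def)

text \<open>Prepending one fixed walk from \<open>y\<close> to \<open>x\<close> lengthens every walk
  by the same amount, so \<open>d\<close> can be chosen independently of \<open>k\<close>.\<close>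

lemma graph_ball_change_center:
  assumes "y \<rightarrow>\<^sup>* x"
  obtains d where "\<And>k. graph_ball G x k \<subseteq> graph_ball G y (k + d)"
proof -
  obtain q where q: "awalk y q x" using assms reachable_awalk by blast
  have "graph_ball G x k \<subseteq> graph_ball G y (k + length q)" for k
  proof
    fix v assume "v \<in> graph_ball G x k"
    then obtain p where "awalk x p v" "length p \<le> k" by (auto simp: graph_ball_def)
    then have "awalk y (q @ p) v \<and> length (q @ p) \<le> k + length q"
      using q awalk_appendI by auto
    then show "v \<in> graph_ball G y (k + length q)" unfolding graph_ball_def by blast
  qed
  then show thesis by (rule that)
qed

end

section \<open>Vertex orbits and the automorphism group\<close>

abbreviation vorbit :: "'a pair_pre_digraph \<Rightarrow> ('a \<Rightarrow> 'a) set \<Rightarrow> 'a \<Rightarrow> 'a set" where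
  "vorbit X \<Gamma> v \<equiv> orbit (Aut X\<lparr>carrier := \<Gamma>\<rparr>) (\<lambda>\<gamma>. \<gamma>) v"

text \<open>Counting orbits on a ball of \<open>X\<close> itself lets different groups be compared
  on one and the same finite set, instead of on different quotient graphs.\<close>

definition orbit_count ::
  "'a pair_pre_digraph \<Rightarrow> ('a \<Rightarrow> 'a) set \<Rightarrow> 'a \<Rightarrow> nat \<Rightarrow> nat" where
  "orbit_count X \<Gamma> x k = card (vorbit X \<Gamma> ` graph_ball (with_proj X) x k)"

lemma vorbit_eq: "vorbit X \<Gamma> v = (\<lambda>\<gamma>. \<gamma> v) ` \<Gamma>"
  by (auto simp: orbit_def)

lemma subgroup_Aut: "subgroup (carrier (Aut X)) (BijGroup (pverts X))"
proof -
  interpret B: group "BijGroup (pverts X)" by (rule group_BijGroup)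
  let ?V = "pverts X"
  show ?thesis
  proof (rule B.subgroupI)
    show "carrier (Aut X) \<subseteq> carrier (BijGroup ?V)"
      by (auto simp: Aut_def BijGroup_def)
    \<comment> \<open>Elements of \<open>Bij\<close> are extensional, so the identity has to be
      restricted to the vertices.\<close>
    have "(\<lambda>x\<in>?V. x) \<in> carrier (Aut X)"
      by (auto simp: Aut_def id_Bij)
    then show "carrier (Aut X) \<noteq> {}" by blast
  next
    fix f assume f: "f \<in> carrier (Aut X)"
    then have fB: "f \<in> Bij ?V" and im: "f ` ?V = ?V"
      by (auto simp: Aut_def Bij_def bij_betw_def)
    \<comment> \<open>Adjacency is both preserved and reflected by \<open>f\<close>, so the
      equivalence for \<open>f\<close> at the preimages of \<open>u\<close> and \<open>v\<close> is
      the one for the inverse.\<close>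
    have "(inv_into ?V f u, inv_into ?V f v) \<in> parcs X \<longleftrightarrow> (u, v) \<in> parcs X"
      if "u \<in> ?V" "v \<in> ?V" for u v
      using f that Bij_inv_into_mem[OF fB] f_inv_into_f[of _ f ?V] im
      by (auto simp: Aut_def)
    then show "inv\<^bsub>BijGroup ?V\<^esub> f \<in> carrier (Aut X)"
      using restrict_inv_into_Bij[OF fB] by (auto simp: inv_BijGroup[OF fB] Aut_def)
  next
    fix f g assume "f \<in> carrier (Aut X)" "g \<in> carrier (Aut X)"
    then show "f \<otimes>\<^bsub>BijGroup ?V\<^esub> g \<in> carrier (Aut X)"
      by (simp add: Aut_def BijGroup_def compose_Bij compose_eq)
        (metis Bij_imp_funcset funcset_mem)
  qed
qed

lemma Aut_eq: "Aut X = BijGroup (pverts X)\<lparr>carrier := carrier (Aut X)\<rparr>"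
  by (simp add: Aut_def)

lemma group_Aut: "group (Aut X)"
  using subgroup.subgroup_is_group[OF subgroup_Aut group_BijGroup] Aut_eq by metis

text \<open>The inclusion of \<open>\<Gamma>\<close> into the group of bijections is a homomorphism,
  which makes the library facts on orbits as equivalence classes available.\<close>

lemma group_action_Aut:
  assumes "subgroup \<Gamma> (Aut X)"
  shows "group_action (Aut X\<lparr>carrier := \<Gamma>\<rparr>) (pverts X) (\<lambda>\<gamma>. \<gamma>)"
proof -
  have "group (Aut X\<lparr>carrier := \<Gamma>\<rparr>)"
    using assms group_Aut by (rule subgroup.subgroup_is_group)
  moreover have "(\<lambda>\<gamma>. \<gamma>) \<in> hom (Aut X\<lparr>carrier := \<Gamma>\<rparr>) (BijGroup (pverts X))"
    using subgroup.subset[OF assms] by (auto simp: hom_def Aut_def BijGroup_def)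
  ultimately show ?thesis
    by (simp add: group_action_def group_hom_def group_hom_axioms_def group_BijGroup)
qed

lemma vorbit_eqI:
  assumes "subgroup \<Gamma> (Aut X)" "v \<in> pverts X" "u \<in> vorbit X \<Gamma> v"
  shows "vorbit X \<Gamma> u = vorbit X \<Gamma> v"
proof -
  interpret group_action "Aut X\<lparr>carrier := \<Gamma>\<rparr>" "pverts X" "\<lambda>\<gamma>. \<gamma>"
    using assms(1) by (rule group_action_Aut)
  have closed: "w \<in> pverts X" if "w \<in> vorbit X \<Gamma> z" "z \<in> pverts X" for w z
    using that element_image by (auto simp: orbit_def)
  have "u \<in> pverts X" using assms closed by blast
  then show ?thesis
    using assms closed orbit_trans orbit_sym by (intro Set.set_eqI iffI) meson+
qed

lemma vorbit_refl: "subgroup \<Gamma> (Aut X) \<Longrightarrow> v \<in> pverts X \<Longrightarrow> v \<in> vorbit X \<Gamma> v"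
  using group_action.orbit_refl[OF group_action_Aut] .

lemma Aut_vertex: "f \<in> carrier (Aut X) \<Longrightarrow> v \<in> pverts X \<Longrightarrow> f v \<in> pverts X"
  by (auto simp: Aut_def dest: Bij_imp_funcset)

lemma Aut_inj_on: "f \<in> carrier (Aut X) \<Longrightarrow> inj_on f (pverts X)"
  by (auto simp: Aut_def Bij_def bij_betw_def)

lemma Aut_image: "f \<in> carrier (Aut X) \<Longrightarrow> f ` pverts X = pverts X"
  by (auto simp: Aut_def Bij_def bij_betw_def)

text \<open>Multiplication in \<open>BijGroup\<close> is composition restricted to the vertex set,
  hence the evaluation at a vertex.\<close>

lemma Aut_mult_apply:
  assumes "f \<in> carrier (Aut X)" "g \<in> carrier (Aut X)" "v \<in> pverts X"
  shows "(f \<otimes>\<^bsub>Aut X\<^esub> g) v = f (g v)"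
  using assms by (auto simp: Aut_def BijGroup_def compose_eq)

lemma Aut_inv_apply:
  assumes "f \<in> carrier (Aut X)" "v \<in> pverts X"
  shows "(inv\<^bsub>Aut X\<^esub> f) (f v) = v"
proof -
  interpret group "Aut X" by (rule group_Aut)
  have "(inv\<^bsub>Aut X\<^esub> f) (f v) = \<one>\<^bsub>Aut X\<^esub> v"
    using assms by (metis Aut_mult_apply inv_closed l_inv)
  then show ?thesis using assms(2) by (simp add: Aut_def BijGroup_def)
qed

section \<open>Automorphisms acting on arcs and balls\<close>

context pair_wf_digraph
begin

lemma Aut_arc:
  "f \<in> carrier (Aut G) \<Longrightarrow> (u, v) \<in> parcs G \<Longrightarrow> (f u, f v) \<in> parcs G"
  using arc_fst_in_verts[of "(u, v)"] arc_snd_in_verts[of "(u, v)"] by (simp add: Aut_def)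

lemma out_arcs_Aut:
  assumes "f \<in> carrier (Aut G)" "x \<in> pverts G"
  shows "out_arcs (with_proj G) (f x) = map_prod f f ` out_arcs (with_proj G) x"
proof (intro Set.set_eqI iffI)
  fix e assume "e \<in> out_arcs (with_proj G) (f x)"
  then obtain b where e: "e = (f x, b)" "(f x, b) \<in> parcs G" by (cases e) auto
  then have "b \<in> pverts G" using arc_snd_in_verts by fastforce
  \<comment> \<open>Surjectivity of \<open>f\<close> on vertices gives a preimage of the head, and
    since \<open>f\<close> reflects adjacency the whole arc pulls back to one leaving
    \<open>x\<close>.\<close>
  then obtain c where "c \<in> pverts G" "b = f c" using Aut_image[OF assms(1)] by blast
  with e assms have "(x, c) \<in> parcs G" "e = map_prod f f (x, c)" by (auto simp: Aut_def)
  then show "e \<in> map_prod f f ` out_arcs (with_proj G) x" by (auto intro!: imageI)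
next
  fix e assume "e \<in> map_prod f f ` out_arcs (with_proj G) x"
  then show "e \<in> out_arcs (with_proj G) (f x)" using Aut_arc[OF assms(1)] by auto
qed

lemma graph_ball_Aut:
  assumes "f \<in> carrier (Aut G)" "x \<in> pverts G"
  shows "graph_ball (with_proj G) (f x) k = f ` graph_ball (with_proj G) x k"
  using assms(2)
proof (induction k arbitrary: x)
  case 0
  then show ?case using assms(1) by (simp add: graph_ball_0 Aut_vertex)
next
  case (Suc k)
  have "graph_ball (with_proj G) (f (snd e)) k = f ` graph_ball (with_proj G) (snd e) k"
    if "e \<in> out_arcs (with_proj G) x" for e
    using that Suc.IH arc_snd_in_verts by auto
  then show ?case
    using Suc.prems assms(1)
    by (simp add: graph_ball_Suc Aut_vertex out_arcs_Aut image_UN)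
qed

section \<open>Balls in the quotient graph\<close>

lemma fst_image_arc_orbit:
  "fst ` orbit (Aut G\<lparr>carrier := \<Gamma>\<rparr>) (\<lambda>\<gamma>. map_prod \<gamma> \<gamma>) e = vorbit G \<Gamma> (fst e)"
  by (simp add: orbit_def setcompr_eq_image image_image)

lemma snd_image_arc_orbit:
  "snd ` orbit (Aut G\<lparr>carrier := \<Gamma>\<rparr>) (\<lambda>\<gamma>. map_prod \<gamma> \<gamma>) e = vorbit G \<Gamma> (snd e)"
  by (simp add: orbit_def setcompr_eq_image image_image)

lemma wf_quotient_graph: "wf_digraph (quotient_graph G \<Gamma>)"
proof
  fix e assume "e \<in> arcs (quotient_graph G \<Gamma>)"
  then obtain a where a: "a \<in> parcs G"
    "e = orbit (Aut G\<lparr>carrier := \<Gamma>\<rparr>) (\<lambda>\<gamma>. map_prod \<gamma> \<gamma>) a"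
    by (auto simp: quotient_graph_def orbits_def)
  show "tail (quotient_graph G \<Gamma>) e \<in> verts (quotient_graph G \<Gamma>)"
    using arc_fst_in_verts[OF a(1)]
    by (auto simp: quotient_graph_def a(2) fst_image_arc_orbit orbits_def)
  show "head (quotient_graph G \<Gamma>) e \<in> verts (quotient_graph G \<Gamma>)"
    using arc_snd_in_verts[OF a(1)]
    by (auto simp: quotient_graph_def a(2) snd_image_arc_orbit orbits_def)
qed

text \<open>This is path lifting for a single step: an arc orbit with tail
  \<open>vorbit G \<Gamma> x\<close> has a representative \<open>(a, b)\<close>, and some
  \<open>\<gamma>\<close> in \<open>\<Gamma>\<close> carries \<open>a\<close> to \<open>x\<close>.
  Distinct arc orbits may share a head, so only the sets of heads are compared; balls depend on
  nothing more.\<close>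

lemma head_image_out_arcs_quotient_graph:
  assumes "subgroup \<Gamma> (Aut G)" "x \<in> pverts G"
  shows "head (quotient_graph G \<Gamma>) ` out_arcs (quotient_graph G \<Gamma>) (vorbit G \<Gamma> x)
    = (\<lambda>e. vorbit G \<Gamma> (snd e)) ` out_arcs (with_proj G) x" (is "?L = ?R")
proof (intro Set.set_eqI iffI)
  fix O1 assume "O1 \<in> ?L"
  then obtain a b where ab: "(a, b) \<in> parcs G"
    and a: "vorbit G \<Gamma> a = vorbit G \<Gamma> x" and O1: "O1 = vorbit G \<Gamma> b"
    by (auto simp: quotient_graph_def orbits_def fst_image_arc_orbit snd_image_arc_orbit)
  have "x \<in> vorbit G \<Gamma> a" using vorbit_refl[OF assms] a by simp
  then obtain \<gamma> where \<gamma>: "\<gamma> \<in> \<Gamma>" "x = \<gamma> a" by (auto simp: vorbit_eq)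
  then have "(x, \<gamma> b) \<in> parcs G"
    using Aut_arc[OF _ ab] subgroup.subset[OF assms(1)] by blast
  moreover have "vorbit G \<Gamma> (\<gamma> b) = O1"
    using vorbit_eqI[OF assms(1), of b "\<gamma> b"] arc_snd_in_verts[OF ab] \<gamma>(1)
    by (auto simp: O1 vorbit_eq)
  ultimately show "O1 \<in> ?R" by (auto intro!: image_eqI[of _ _ "(x, \<gamma> b)"])
next
  fix O1 assume "O1 \<in> ?R"
  then obtain b where b: "(x, b) \<in> parcs G" "O1 = vorbit G \<Gamma> b" by auto
  let ?e = "orbit (Aut G\<lparr>carrier := \<Gamma>\<rparr>) (\<lambda>\<gamma>. map_prod \<gamma> \<gamma>) (x, b)"
  have "?e \<in> out_arcs (quotient_graph G \<Gamma>) (vorbit G \<Gamma> x)"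
    using b(1) by (auto simp: quotient_graph_def orbits_def fst_image_arc_orbit)
  moreover have "head (quotient_graph G \<Gamma>) ?e = O1"
    by (simp add: quotient_graph_def snd_image_arc_orbit b(2))
  ultimately show "O1 \<in> ?L" by blast
qed

lemma graph_ball_quotient_graph:
  assumes "subgroup \<Gamma> (Aut G)" "x \<in> pverts G"
  shows "graph_ball (quotient_graph G \<Gamma>) (vorbit G \<Gamma> x) k
    = vorbit G \<Gamma> ` graph_ball (with_proj G) x k"
  using assms(2)
proof (induction k arbitrary: x)
  interpret Q: wf_digraph "quotient_graph G \<Gamma>" by (rule wf_quotient_graph)
  have vert: "vorbit G \<Gamma> v \<in> verts (quotient_graph G \<Gamma>)" if "v \<in> pverts G" for v
    using that by (auto simp: quotient_graph_def orbits_def)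
  {
    case 0
    then show ?case by (simp add: graph_ball_0 Q.graph_ball_0 vert)
  next
    case (Suc k)
    let ?Q = "quotient_graph G \<Gamma>"
    \<comment> \<open>The union depends on the arcs only through their heads, so it can be indexed
      by the heads and the one-step lifting applies.\<close>
    have "(\<Union>e\<in>out_arcs ?Q (vorbit G \<Gamma> x). graph_ball ?Q (head ?Q e) k)
        = (\<Union>O1\<in>head ?Q ` out_arcs ?Q (vorbit G \<Gamma> x). graph_ball ?Q O1 k)"
      by simp
    also have "\<dots> = (\<Union>e\<in>out_arcs (with_proj G) x. graph_ball ?Q (vorbit G \<Gamma> (snd e)) k)"
      by (simp add: head_image_out_arcs_quotient_graph[OF assms(1) Suc.prems])
    also have "\<dots> = (\<Union>e\<in>out_arcs (with_proj G) x.
        vorbit G \<Gamma> ` graph_ball (with_proj G) (snd e) k)"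
      using Suc.IH arc_snd_in_verts by auto
    finally show ?case
      using Suc.prems by (simp add: graph_ball_Suc Q.graph_ball_Suc vert image_UN)
  }
qed

lemma growth_function_quotient_graph:
  assumes "subgroup \<Gamma> (Aut G)" "x \<in> pverts G"
  shows "growth_function (quotient_graph G \<Gamma>) (vorbit G \<Gamma> x) = orbit_count G \<Gamma> x"
  by (simp add: fun_eq_iff growth_function_def orbit_count_def graph_ball_quotient_graph[OF assms])

section \<open>Orbit counts for a subgroup of finite index\<close>

lemma orbit_count_subgroup_le:
  assumes "locally_finite (with_proj G)" "subgroup \<Gamma> (Aut G)" "subgroup \<Lambda> (Aut G)" "\<Lambda> \<subseteq> \<Gamma>"
    and "x \<in> pverts G"
  shows "orbit_count G \<Gamma> x k \<le> orbit_count G \<Lambda> x k"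
proof -
  let ?B = "graph_ball (with_proj G) x k"
  have fin: "finite ?B" using finite_graph_ball assms by simp
  \<comment> \<open>This recovers the \<open>\<Gamma>\<close>-orbit of \<open>v\<close> from its
    \<open>\<Lambda>\<close>-orbit alone, so the \<open>\<Lambda>\<close>-orbits meeting the ball
    map onto the \<open>\<Gamma>\<close>-orbits meeting it.\<close>
  have "vorbit G \<Gamma> v = \<Union> (vorbit G \<Gamma> ` vorbit G \<Lambda> v)" if "v \<in> ?B" for v
  proof -
    have v: "v \<in> pverts G" using graph_ball_subset_verts that by auto
    have "vorbit G \<Gamma> u = vorbit G \<Gamma> v" if "u \<in> vorbit G \<Lambda> v" for u
      using vorbit_eqI[OF assms(2) v] that assms(4) by (auto simp: vorbit_eq)
    then show ?thesis using vorbit_refl[OF assms(3) v] by blast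
  qed
  then have "vorbit G \<Gamma> ` ?B = (\<lambda>O1. \<Union> (vorbit G \<Gamma> ` O1)) ` vorbit G \<Lambda> ` ?B"
    unfolding image_image by (intro image_cong refl)
  then show ?thesis
    unfolding orbit_count_def using card_image_le[of "vorbit G \<Lambda> ` ?B"] fin by simp
qed

text \<open>Evaluation at \<open>v\<close> sends the coset \<open>\<Lambda>\<gamma>\<close> to the
  \<open>\<Lambda>\<close>-orbit of \<open>\<gamma> v\<close>. The cosets thus map onto the
  \<open>\<Lambda>\<close>-orbits inside the \<open>\<Gamma>\<close>-orbit of \<open>v\<close>,
  possibly with repetitions when \<open>v\<close> has a stabilizer.\<close>

lemma card_orbits_in_orbit_le:
  assumes "subgroup \<Gamma> (Aut G)" "finite_index (Aut G) \<Lambda> \<Gamma>" "v \<in> pverts G"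
  defines "R \<equiv> rcosets\<^bsub>Aut G\<lparr>carrier := \<Gamma>\<rparr>\<^esub> \<Lambda>"
  shows "finite (vorbit G \<Lambda> ` vorbit G \<Gamma> v)" "card (vorbit G \<Lambda> ` vorbit G \<Gamma> v) \<le> card R"
proof -
  have fin: "finite R" and sub: "\<Lambda> \<subseteq> \<Gamma>" "\<Gamma> \<subseteq> carrier (Aut G)"
    using assms(2) subgroup.subset[OF assms(1)] by (simp_all add: finite_index_def R_def)
  have "vorbit G \<Lambda> (\<gamma> v) = (\<lambda>f. f v) ` (\<Lambda> #>\<^bsub>Aut G\<lparr>carrier := \<Gamma>\<rparr>\<^esub> \<gamma>)" if "\<gamma> \<in> \<Gamma>" for \<gamma>
  proof -
    have "(f \<otimes>\<^bsub>Aut G\<^esub> \<gamma>) v = f (\<gamma> v)" if "f \<in> \<Lambda>" for f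
      using sub that \<open>\<gamma> \<in> \<Gamma>\<close> by (intro Aut_mult_apply assms(3)) auto
    then show ?thesis
      by (simp add: vorbit_eq r_coset_def UNION_singleton_eq_range image_image cong: image_cong)
  qed
  then have "vorbit G \<Lambda> ` vorbit G \<Gamma> v
      = (\<lambda>\<gamma>. (\<lambda>f. f v) ` (\<Lambda> #>\<^bsub>Aut G\<lparr>carrier := \<Gamma>\<rparr>\<^esub> \<gamma>)) ` \<Gamma>"
    unfolding vorbit_eq[of \<Gamma> G] image_image by (intro image_cong refl)
  then have *: "vorbit G \<Lambda> ` vorbit G \<Gamma> v = (`) (\<lambda>f. f v) ` R"
    by (simp add: R_def RCOSETS_def UNION_singleton_eq_range image_image)
  show "finite (vorbit G \<Lambda> ` vorbit G \<Gamma> v)"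
    unfolding * using fin by (rule finite_imageI)
  show "card (vorbit G \<Lambda> ` vorbit G \<Gamma> v) \<le> card R"
    unfolding * using fin by (rule card_image_le)
qed

lemma orbit_count_le_subgroup:
  assumes "locally_finite (with_proj G)" "subgroup \<Gamma> (Aut G)" "finite_index (Aut G) \<Lambda> \<Gamma>"
    and "x \<in> pverts G"
  shows "orbit_count G \<Lambda> x k
    \<le> card (rcosets\<^bsub>Aut G\<lparr>carrier := \<Gamma>\<rparr>\<^esub> \<Lambda>) * orbit_count G \<Gamma> x k"
proof -
  let ?B = "graph_ball (with_proj G) x k" and ?n = "card (rcosets\<^bsub>Aut G\<lparr>carrier := \<Gamma>\<rparr>\<^esub> \<Lambda>)"
  have B: "finite ?B" "?B \<subseteq> pverts G"
    using finite_graph_ball assms graph_ball_subset_verts by simp_all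
  \<comment> \<open>\<open>?U\<close> also contains \<open>\<Lambda>\<close>-orbits that miss the
    ball but lie in a \<open>\<Gamma>\<close>-orbit meeting it. For an upper bound this overcount is
    harmless, and it allows a count fiber by fiber.\<close>
  let ?U = "\<Union>O1\<in>vorbit G \<Gamma> ` ?B. vorbit G \<Lambda> ` O1"
  have "finite ?U"
    using B card_orbits_in_orbit_le(1)[OF assms(2,3)] by auto
  moreover have "vorbit G \<Lambda> ` ?B \<subseteq> ?U"
    using B(2) vorbit_refl[OF assms(2)] by blast
  ultimately have "card (vorbit G \<Lambda> ` ?B) \<le> card ?U" by (rule card_mono)
  also have "\<dots> \<le> (\<Sum>O1\<in>vorbit G \<Gamma> ` ?B. card (vorbit G \<Lambda> ` O1))"
    using B(1) by (intro card_UN_le) simp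
  also have "\<dots> \<le> of_nat (card (vorbit G \<Gamma> ` ?B)) * ?n"
    using B(2) card_orbits_in_orbit_le(2)[OF assms(2,3)] by (intro sum_bounded_above) auto
  finally show ?thesis by (simp add: orbit_count_def mult.commute)
qed

lemma growth_equiv_orbit_count_finite_index:
  assumes "locally_finite (with_proj G)" "subgroup \<Gamma> (Aut G)" "subgroup \<Lambda> (Aut G)"
    and "finite_index (Aut G) \<Lambda> \<Gamma>" "x \<in> pverts G"
  shows "growth_equiv (orbit_count G \<Lambda> x) (orbit_count G \<Gamma> x)"
proof -
  have "\<Lambda> \<subseteq> \<Gamma>" using assms(4) by (simp add: finite_index_def)
  \<comment> \<open>Both comparisons hold at equal radius, so \<beta> is 0; \<alpha> is 1 in this
    direction and the index in the other.\<close>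
  then have "orbit_count G \<Gamma> x k \<le> 1 * orbit_count G \<Lambda> x (k + 0)" for k
    using orbit_count_subgroup_le assms by simp
  moreover have "orbit_count G \<Lambda> x k
    \<le> card (rcosets\<^bsub>Aut G\<lparr>carrier := \<Gamma>\<rparr>\<^esub> \<Lambda>) * orbit_count G \<Gamma> x (k + 0)" for k
    using orbit_count_le_subgroup assms by simp
  ultimately show ?thesis unfolding growth_equiv_def growth_le_def by blast
qed

section \<open>Conjugation and change of basepoint\<close>

lemma orbit_count_conjugate:
  assumes "subgroup \<Gamma> (Aut G)" "g \<in> carrier (Aut G)" "x \<in> pverts G"
  shows "orbit_count G (g <#\<^bsub>Aut G\<^esub> \<Gamma> #>\<^bsub>Aut G\<^esub> inv\<^bsub>Aut G\<^esub> g) (g x) k = orbit_count G \<Gamma> x k"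
proof -
  interpret A: group "Aut G" by (rule group_Aut)
  let ?\<Gamma> = "g <#\<^bsub>Aut G\<^esub> \<Gamma> #>\<^bsub>Aut G\<^esub> inv\<^bsub>Aut G\<^esub> g"
  let ?B = "graph_ball (with_proj G) x k"
  have sub: "\<Gamma> \<subseteq> carrier (Aut G)" using assms(1) by (rule subgroup.subset)
  \<comment> \<open>The trailing inverse of \<open>g\<close> cancels against the \<open>g\<close> in
    \<open>g v\<close>, which is why the basepoint has to move along with the group.\<close>
  have orb: "vorbit G ?\<Gamma> (g v) = g ` vorbit G \<Gamma> v" if v: "v \<in> pverts G" for v
  proof -
    have "(g \<otimes>\<^bsub>Aut G\<^esub> \<gamma> \<otimes>\<^bsub>Aut G\<^esub> inv\<^bsub>Aut G\<^esub> g) (g v) = g (\<gamma> v)" if "\<gamma> \<in> \<Gamma>" for \<gamma>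
      using that sub v assms(2) by (simp add: subsetD Aut_mult_apply Aut_inv_apply Aut_vertex)
    then show ?thesis
      by (simp add: vorbit_eq l_coset_def r_coset_def UNION_singleton_eq_range image_image
          cong: image_cong)
  qed
  have B: "?B \<subseteq> pverts G" using graph_ball_subset_verts by simp
  then have orbs: "vorbit G ?\<Gamma> ` graph_ball (with_proj G) (g x) k = (`) g ` vorbit G \<Gamma> ` ?B"
    unfolding graph_ball_Aut[OF assms(2,3)] image_image using orb by (intro image_cong) blast+
  \<comment> \<open>Since \<open>g\<close> is known to be injective only on \<open>pverts G\<close>,
    the orbits must consist of vertices before taking images under \<open>g\<close> is injective on
    them.\<close>
  have "vorbit G \<Gamma> v \<subseteq> pverts G" if "v \<in> ?B" for v
  proof
    fix u assume "u \<in> vorbit G \<Gamma> v"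
    then obtain \<gamma> where "\<gamma> \<in> \<Gamma>" "u = \<gamma> v" by (auto simp: vorbit_eq)
    then show "u \<in> pverts G" using Aut_vertex[of \<gamma> G v] that B sub by auto
  qed
  then have "vorbit G \<Gamma> ` ?B \<subseteq> Pow (pverts G)" by (simp add: image_subset_iff)
  then have "inj_on ((`) g) (vorbit G \<Gamma> ` ?B)"
    by (rule inj_on_subset[OF inj_on_image_Pow[OF Aut_inj_on[OF assms(2)]]])
  then show ?thesis unfolding orbit_count_def orbs by (rule card_image)
qed

text \<open>Enlarging the radius by the length of a walk from \<open>y\<close> to \<open>x\<close>
  makes the ball about \<open>y\<close> contain the one about \<open>x\<close>, so every orbit
  meeting the smaller ball meets the larger.\<close>

lemma growth_le_orbit_count_basepoint:
  assumes "locally_finite (with_proj G)" "y \<in> pverts G" "y \<rightarrow>\<^sup>*\<^bsub>with_proj G\<^esub> x"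
  shows "growth_le (orbit_count G \<Gamma> x) (orbit_count G \<Gamma> y)"
proof -
  obtain d where d: "\<And>k. graph_ball (with_proj G) x k \<subseteq> graph_ball (with_proj G) y (k + d)"
    using graph_ball_change_center[OF assms(3)] by blast
  have "orbit_count G \<Gamma> x k \<le> 1 * orbit_count G \<Gamma> y (k + d)" for k
    unfolding orbit_count_def mult_1
    using finite_graph_ball assms(1,2) d by (intro card_mono image_mono) auto
  then show ?thesis unfolding growth_le_def by blast
qed

end

section \<open>Growth of the quotients by commensurable lattices\<close>

theorem proposition3p4:
  fixes X :: "'a pair_pre_digraph" and \<Gamma> \<Gamma>' :: "('a \<Rightarrow> 'a) set"
  assumes "is_tree X"
    and "locally_finite (with_proj X)"
    and "is_lattice (Aut X) (aut_topology X) \<Gamma>"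
    and "is_lattice (Aut X) (aut_topology X) \<Gamma>'"
    and "commensurable (Aut X) \<Gamma> \<Gamma>'"
    and "acts_without_inversions X \<Gamma>"
    and "acts_without_inversions X \<Gamma>'"
  shows "\<forall>s\<in>verts (quotient_graph X \<Gamma>). \<forall>s'\<in>verts (quotient_graph X \<Gamma>').
           growth_type (quotient_graph X \<Gamma>) s = growth_type (quotient_graph X \<Gamma>') s'"
proof (intro ballI)
  interpret X: pair_bidirected_digraph X using assms(1) by (simp add: is_tree_def)
  interpret A: group "Aut X" by (rule group_Aut)
  have reach: "u \<rightarrow>\<^sup>*\<^bsub>with_proj X\<^esub> v" if "u \<in> pverts X" "v \<in> pverts X" for u v
  proof -
    \<comment> \<open>Connectedness ignores the direction of arcs, while walks follow it; the
      symmetry of the arcs of \<open>X\<close> bridges the two.\<close>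
    have "strongly_connected (with_proj X)"
      using X.pair_sym_arcs assms(1) unfolding is_tree_def
      by (intro X.symmetric_connected_imp_strongly_connected) blast+
    then show ?thesis using that by (simp add: strongly_connected_def)
  qed
  have \<Gamma>: "subgroup \<Gamma> (Aut X)" and \<Gamma>': "subgroup \<Gamma>' (Aut X)"
    using assms(3,4) by (simp_all add: is_lattice_def discrete_subgroup_def)
  obtain g where g: "g \<in> carrier (Aut X)"
    and "let \<Gamma>\<^sub>1 = g <#\<^bsub>Aut X\<^esub> \<Gamma> #>\<^bsub>Aut X\<^esub> inv\<^bsub>Aut X\<^esub> g in
      finite_index (Aut X) (\<Gamma>\<^sub>1 \<inter> \<Gamma>') \<Gamma>\<^sub>1 \<and> finite_index (Aut X) (\<Gamma>\<^sub>1 \<inter> \<Gamma>') \<Gamma>'"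
    using assms(5) unfolding commensurable_def by blast
  moreover define \<Gamma>\<^sub>1 where "\<Gamma>\<^sub>1 = g <#\<^bsub>Aut X\<^esub> \<Gamma> #>\<^bsub>Aut X\<^esub> inv\<^bsub>Aut X\<^esub> g"
  ultimately have fi: "finite_index (Aut X) (\<Gamma>\<^sub>1 \<inter> \<Gamma>') \<Gamma>\<^sub>1" "finite_index (Aut X) (\<Gamma>\<^sub>1 \<inter> \<Gamma>') \<Gamma>'"
    by (simp_all add: Let_def)
  have \<Gamma>\<^sub>1: "subgroup \<Gamma>\<^sub>1 (Aut X)"
    unfolding \<Gamma>\<^sub>1_def using g \<Gamma> by (rule A.subgroup_conjugation_is_surj2)
  have \<Lambda>: "subgroup (\<Gamma>\<^sub>1 \<inter> \<Gamma>') (Aut X)"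
    using \<Gamma>\<^sub>1 \<Gamma>' by (rule A.subgroups_Inter_pair)
  fix s s' assume "s \<in> verts (quotient_graph X \<Gamma>)" "s' \<in> verts (quotient_graph X \<Gamma>')"
  then obtain x y where x: "x \<in> pverts X" "s = vorbit X \<Gamma> x"
    and y: "y \<in> pverts X" "s' = vorbit X \<Gamma>' y"
    by (auto simp: quotient_graph_def orbits_def)
  have gx: "g x \<in> pverts X" using g x(1) by (rule Aut_vertex)
  \<comment> \<open>The chain runs from \<open>\<Gamma>\<close> at \<open>x\<close> to
    \<open>\<Gamma>\<^sub>1\<close> at \<open>g x\<close>, down to the intersection, up to
    \<open>\<Gamma>'\<close> at \<open>g x\<close>, and finally to \<open>\<Gamma>'\<close> at
    \<open>y\<close>.\<close>
  have "orbit_count X \<Gamma> x = orbit_count X \<Gamma>\<^sub>1 (g x)"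
    unfolding \<Gamma>\<^sub>1_def using X.orbit_count_conjugate[OF \<Gamma> g x(1)] by (simp add: fun_eq_iff)
  moreover have "growth_equiv (orbit_count X \<Gamma>\<^sub>1 (g x)) (orbit_count X (\<Gamma>\<^sub>1 \<inter> \<Gamma>') (g x))"
    using X.growth_equiv_orbit_count_finite_index[OF assms(2) \<Gamma>\<^sub>1 \<Lambda> fi(1) gx]
    by (rule growth_equiv_sym)
  moreover have "growth_equiv (orbit_count X (\<Gamma>\<^sub>1 \<inter> \<Gamma>') (g x)) (orbit_count X \<Gamma>' (g x))"
    by (rule X.growth_equiv_orbit_count_finite_index[OF assms(2) \<Gamma>' \<Lambda> fi(2) gx])
  moreover have "growth_equiv (orbit_count X \<Gamma>' (g x)) (orbit_count X \<Gamma>' y)"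
    unfolding growth_equiv_def
    by (intro conjI X.growth_le_orbit_count_basepoint assms(2) reach gx y(1))
  ultimately have "growth_equiv (orbit_count X \<Gamma> x) (orbit_count X \<Gamma>' y)"
    by (metis growth_equiv_trans)
  then show "growth_type (quotient_graph X \<Gamma>) s = growth_type (quotient_graph X \<Gamma>') s'"
    unfolding x(2) y(2)
    by (intro growth_type_eqI)
      (simp only: X.growth_function_quotient_graph[OF \<Gamma> x(1)]
        X.growth_function_quotient_graph[OF \<Gamma>' y(1)])
qed

end
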